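(* Let $n\geq 3$ and let $\mathbb{Q}=\mathrm{circ}(Q_1,Q_2,\ldots,Q_n)$, where $Q_k$ is the $k$th Pell-Lucas number. Put $$u_n=Q_1-3Q_n+\sum_{k=2}^{n-1}(Q_{k+1}-3Q_k)\left(\frac{Q_n-2}{Q_1-Q_{n+1}}\right)^{n-k}.$$ Then the inverse of $\mathbb{Q}$ is $\mathbb{Q}^{-1}=\mathrm{circ}(q_1,q_2,\ldots,q_n)$, where $$q_1=\frac{1}{u_n}\left(1-\frac{8(Q_n-2)^{n-3}}{(Q_1-Q_{n+1})^{n-2}}+\sum_{k=1}^{n-3}\frac{(Q_{n-k+2}-3Q_{n-k+1})(Q_n-2)^{k-1}}{(Q_1-Q_{n+1})^{k}}\right),$$ $$q_2=\frac{1}{u_n}\left(-3+\sum_{k=1}^{n-2}(Q_{n-k+1}-3Q_{n-k})\frac{(Q_n-2)^{k-1}}{(Q_1-Q_{n+1})^{k}}\right),$$ $$q_m=\frac{4(Q_n-2)^{m-3}}{u_n(Q_1-Q_{n+1})^{m-2}},\qquad m=3,4,\ldots,n.$$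
   Context: The Pell-Lucas numbers are defined by $Q_0=2$, $Q_1=2$, and $Q_k=2Q_{k-1}+Q_{k-2}$ for $k\geq 2$. For numbers $c_0,c_1,\ldots,c_{n-1}$, $\mathrm{circ}(c_0,c_1,\ldots,c_{n-1})$ denotes the $n\times n$ circulant matrix whose first row is $(c_0,c_1,\ldots,c_{n-1})$ and in which each subsequent row is the cyclic shift of the previous row one position to the right; i.e. its $(i,j)$ entry is $c_{(j-i)\bmod n}$ for $1\le i,j\le n$. Empty sums are $0$. *)

theory Defs
  imports Complex_Main "Jordan_Normal_Form.Matrix"
begin

fun pell_lucas :: "nat \<Rightarrow> nat" where
  "pell_lucas 0 = 2"
| "pell_lucas (Suc 0) = 2"
| "pell_lucas (Suc (Suc k)) = 2 * pell_lucas (Suc k) + pell_lucas k"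

(* circ n c is circ(c 0, ..., c (n - 1)).  Matrix indices start at 0, which does not affect
   j - i; the subtraction is done in int, where it does not truncate. *)
definition circ :: "nat \<Rightarrow> (nat \<Rightarrow> 'a) \<Rightarrow> 'a mat" where
  "circ n c = mat n n (\<lambda>(i, j). c (nat ((int j - int i) mod int n)))"

end

theory Submission
  imports Defs "Jordan_Normal_Form.Determinant"
begin

text \<open>
  Identify circulant matrices with polynomials in the cyclic shift \<open>S\<close>, where \<open>S ^ n = 1\<close>. Put
  \<open>a = Q n - 2\<close>, \<open>b = Q 1 - Q (n + 1)\<close> and \<open>r = a / b\<close>. The recurrence gives
  \<open>(1 - 2 S - S\<^sup>2) * circ(Q 1, ..., Q n) = b - a S\<close>, and \<open>b - a S\<close> has the inverse
  \<open>(\<Sum>j<n. r ^ j * S ^ j) / (b * (1 - r ^ n))\<close>; here \<open>r ^ n \<noteq> 1\<close> because \<open>\<bar>r\<bar> < 1\<close>. Hence the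
  inverse of the circulant is \<open>1 - 2 S - S\<^sup>2\<close> times this geometric sum. Its coefficients have the
  stated form because \<open>u * (r\<^sup>2 - 2 * r - 1) = 4 * (1 - r ^ n)\<close>, which comes from summing the
  second-order recurrent sequence \<open>Q (k + 1) - 3 * Q k\<close> against powers of \<open>r\<close>.
\<close>

text \<open>The sum covers one full period: moving the window by one drops \<open>h c\<close> and
  gains \<open>h (c + n)\<close>, which are equal. Iterating in both directions reaches every
  integer \<open>c\<close>.\<close>

lemma sum_periodic_shift:
  fixes h :: "int \<Rightarrow> 'a::ab_group_add"
  assumes per: "\<And>x. h (x + int n) = h x"
  shows "(\<Sum>i<n. h (int i + c)) = (\<Sum>i<n. h (int i))"
proof -
  have step: "(\<Sum>i<n. h (int i + (c + 1))) = (\<Sum>i<n. h (int i + c))" for c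
  proof -
    have "h c + (\<Sum>i<n. h (int i + (c + 1))) = (\<Sum>i<Suc n. h (int i + c))"
      by (simp only: sum.lessThan_Suc_shift) (simp add: algebra_simps)
    also have "\<dots> = h c + (\<Sum>i<n. h (int i + c))"
      using per[of c] by (simp add: add.commute)
    finally show ?thesis by simp
  qed
  show ?thesis
  proof (induction c rule: int_induct[where k = 0])
    case (step2 i)
    then show ?case using step[of "i - 1"] by simp
  qed (simp_all add: step)
qed

text \<open>With \<open>f\<close> and \<open>g\<close> extended periodically, entry
  \<open>(i, j)\<close> is the sum of \<open>f (k - i) * g (j - k)\<close> over \<open>k\<close>.
  Replacing \<open>k\<close> by \<open>k + i\<close> leaves only the difference
  \<open>j - i\<close>, so the product is a cyclic convolution.\<close>

lemma circ_mult_circ: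
  fixes f g :: "nat \<Rightarrow> 'a::ring"
  shows "circ n f * circ n g =
    circ n (\<lambda>d. \<Sum>i<n. f i * g (nat ((int d - int i) mod int n)))"
proof (rule eq_matI)
  fix i j
  assume "i < dim_row (circ n (\<lambda>d. \<Sum>i<n. f i * g (nat ((int d - int i) mod int n))))"
    and "j < dim_col (circ n (\<lambda>d. \<Sum>i<n. f i * g (nat ((int d - int i) mod int n))))"
  then have ij: "i < n" "j < n" by (simp_all add: circ_def)
  define h where "h x = f (nat (x mod int n)) * g (nat ((int j - int i - x) mod int n))" for x
  have per: "h (x + int n) = h x" for x
  proof -
    have "(int j - int i - (x + int n)) mod int n = (int j - int i - x) mod int n"
      by (metis diff_diff_eq minus_mod_self2)
    then show ?thesis by (simp add: h_def)
  qed
  have "(circ n f * circ n g) $$ (i, j) = (\<Sum>k<n. h (int k + (- int i)))"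
    using ij by (simp add: circ_def scalar_prod_def h_def atLeast0LessThan)
  also have "\<dots> = (\<Sum>k<n. h (int k))"
    by (rule sum_periodic_shift) (rule per)
  also have "\<dots> = (\<Sum>k<n. f k * g (nat ((int (nat ((int j - int i) mod int n)) - int k) mod int n)))"
    using ij by (intro sum.cong) (simp_all add: h_def mod_simps)
  finally show "(circ n f * circ n g) $$ (i, j) =
      circ n (\<lambda>d. \<Sum>i<n. f i * g (nat ((int d - int i) mod int n))) $$ (i, j)"
    using ij by (simp add: circ_def)
qed (simp_all add: circ_def)

text \<open>The hypothesis makes \<open>g\<close> a convolution inverse of \<open>f\<close>, which
  gives one product. The other follows because a one-sided inverse of a square matrix over a field
  is two-sided.\<close>

lemma circ_inverts_mat:
  fixes f g :: "nat \<Rightarrow> 'a::field"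
  assumes "\<And>d. d < n \<Longrightarrow>
    (\<Sum>i<n. f i * g (nat ((int d - int i) mod int n))) = (if d = 0 then 1 else 0)"
  shows "inverts_mat (circ n f) (circ n g) \<and> inverts_mat (circ n g) (circ n f)"
proof -
  have carrier: "circ n f \<in> carrier_mat n n" "circ n g \<in> carrier_mat n n"
    by (simp_all add: circ_def)
  have "circ n f * circ n g = 1\<^sub>m n"
  proof (rule eq_matI)
    fix i j
    assume "i < dim_row (1\<^sub>m n :: 'a mat)" "j < dim_col (1\<^sub>m n :: 'a mat)"
    then have ij: "i < n" "j < n" by simp_all
    define d where "d = nat ((int j - int i) mod int n)"
    have d: "d < n"
      using ij by (simp add: d_def nat_less_iff)
    have "d = 0 \<longleftrightarrow> (int j - int i) mod int n = 0"
      using ij pos_mod_sign[of "int n" "int j - int i"] unfolding d_def by linarith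
    also have "\<dots> \<longleftrightarrow> int j mod int n = int i mod int n"
      by (simp only: mod_eq_dvd_iff dvd_eq_mod_eq_0)
    also have "\<dots> \<longleftrightarrow> i = j"
      using ij by auto
    finally have d0: "d = 0 \<longleftrightarrow> i = j" .
    have "(circ n f * circ n g) $$ (i, j) =
        (\<Sum>k<n. f k * g (nat ((int d - int k) mod int n)))"
      unfolding circ_mult_circ using ij by (simp add: circ_def d_def)
    also have "\<dots> = 1\<^sub>m n $$ (i, j)"
      using ij d0 by (simp add: assms[OF d])
    finally show "(circ n f * circ n g) $$ (i, j) = 1\<^sub>m n $$ (i, j)" .
  qed (simp_all add: circ_def)
  moreover from this have "circ n g * circ n f = 1\<^sub>m n"
    using mat_mult_left_right_inverse carrier by blast
  ultimately show ?thesis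
    using carrier by (simp add: inverts_mat_def)
qed

lemma pell_lucas_ge_2: "2 \<le> pell_lucas k"
  by (induction k rule: pell_lucas.induct) simp_all

text \<open>The factor is the characteristic polynomial of the recurrence at \<open>r\<close>, so
  multiplying by it leaves only boundary terms.\<close>

lemma pell_lucas_recurrence_weighted_sum:
  fixes e :: "nat \<Rightarrow> 'a::comm_ring_1"
  assumes "\<And>k. e (k + 2) = 2 * e (k + 1) + e k"
  shows "(r\<^sup>2 - 2 * r - 1) * (\<Sum>k = 1..m. e k * r ^ (m - k)) =
    e 1 * r ^ (m + 1) + e 0 * r ^ m - e (m + 1) * r - e m"
proof (induction m)
  case (Suc m)
  have "(\<Sum>k = 1..Suc m. e k * r ^ (Suc m - k)) = r * (\<Sum>k = 1..m. e k * r ^ (m - k)) + e (Suc m)"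
    by (simp add: sum_distrib_left Suc_diff_le algebra_simps)
  then have "(r\<^sup>2 - 2 * r - 1) * (\<Sum>k = 1..Suc m. e k * r ^ (Suc m - k)) =
      r * ((r\<^sup>2 - 2 * r - 1) * (\<Sum>k = 1..m. e k * r ^ (m - k))) + (r\<^sup>2 - 2 * r - 1) * e (Suc m)"
    by (simp add: algebra_simps)
  then show ?case
    unfolding Suc.IH using assms[of m] by (simp add: algebra_simps power2_eq_square)
qed simp

theorem theorem9:
  fixes n :: nat and Q q :: "nat \<Rightarrow> real" and u :: real
  assumes "n \<ge> 3"
    and "\<And>k. Q k = real (pell_lucas k)"
    and "u = Q 1 - 3 * Q n
           + (\<Sum>k = 2..n - 1. (Q (k + 1) - 3 * Q k) * ((Q n - 2) / (Q 1 - Q (n + 1))) ^ (n - k))"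
    and "q 1 = 1 / u * (1 - 8 * (Q n - 2) ^ (n - 3) / (Q 1 - Q (n + 1)) ^ (n - 2)
           + (\<Sum>k = 1..n - 3. (Q (n - k + 2) - 3 * Q (n - k + 1)) * (Q n - 2) ^ (k - 1)
                / (Q 1 - Q (n + 1)) ^ k))"
    and "q 2 = 1 / u * (- 3
           + (\<Sum>k = 1..n - 2. (Q (n - k + 1) - 3 * Q (n - k))
                * ((Q n - 2) ^ (k - 1) / (Q 1 - Q (n + 1)) ^ k)))"
    and "\<And>m. 3 \<le> m \<Longrightarrow> m \<le> n \<Longrightarrow>
           q m = 4 * (Q n - 2) ^ (m - 3) / (u * (Q 1 - Q (n + 1)) ^ (m - 2))"
  shows "inverts_mat (circ n (\<lambda>i. Q (i + 1))) (circ n (\<lambda>i. q (i + 1)))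
       \<and> inverts_mat (circ n (\<lambda>i. q (i + 1))) (circ n (\<lambda>i. Q (i + 1)))"
proof -
  have n3: "3 \<le> n" and Qdef: "\<And>k. Q k = real (pell_lucas k)" using assms(1,2) by auto
  define a b r where "a = Q n - 2" and "b = Q 1 - Q (n + 1)" and "r = a / b"
  \<comment> \<open>\<open>e\<close> inherits the recurrence of \<open>Q\<close>, and
    \<open>p\<close> is its characteristic polynomial at \<open>r\<close>; hence
    \<open>p * T m\<close> has a closed form.\<close>
  define e where "e k = Q (k + 1) - 3 * Q k" for k
  define T where "T m = (\<Sum>k = 1..m. e k * r ^ (m - k))" for m
  define p where "p = r\<^sup>2 - 2 * r - 1"
  have Q_rec: "Q (k + 2) = 2 * Q (k + 1) + Q k" for k
    by (simp add: Qdef)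
  have Q_init: "Q 0 = 2" "Q 1 = 2" "Q 2 = 6" "Q 3 = 14" "Q 4 = 34"
    by (simp_all add: Qdef numeral_eq_Suc)
  have e_rec: "e (k + 2) = 2 * e (k + 1) + e k" for k
    using Q_rec[of k] Q_rec[of "k + 1"] by (simp add: e_def algebra_simps)
  have e_init: "e 0 = - 4" "e 1 = 0" "e 2 = - 4" "e 3 = - 8"
    using Q_init by (simp_all add: e_def numeral_eq_Suc)
  have Q_pred: "Q (n + 1) = 2 * Q n + Q (n - 1)"
    using Q_rec[of "n - 1"] n3 by simp
  have Q_ge: "2 \<le> Q k" for k
    using pell_lucas_ge_2[of k] by (simp add: Qdef)
  \<comment> \<open>Here \<open>- b - a = Q (n + 1) - Q n = Q n + Q (n - 1)\<close>, which is
    positive.\<close>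
  have ab: "0 \<le> a" "a < - b"
    using Q_pred Q_ge[of n] Q_ge[of "n - 1"] Q_init by (simp_all add: a_def b_def)
  then have b_neg: "b < 0" and br: "b * r = a"
    by (simp_all add: r_def)
  have "\<bar>r\<bar> < 1"
    using ab b_neg by (simp add: r_def abs_if field_simps)
  then have "\<bar>r ^ n\<bar> < 1"
    using n3 by (simp add: power_abs power_less_one_iff)
  then have rn: "1 - r ^ n \<noteq> 0"
    by auto
  have e_n: "e n = - 4 - b - 3 * a" and e_n1: "e (n + 1) = a + b"
    using Q_rec[of n] Q_init by (simp_all add: e_def a_def b_def)
  have e_pred: "e (n - 1) = 7 * a + 8 + 3 * b"
    using Q_pred Q_init n3 by (simp add: e_def a_def b_def)
  have pT: "p * T m = - 4 * r ^ m - e (m + 1) * r - e m" for m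
    using pell_lucas_recurrence_weighted_sum[of e r m] e_rec e_init by (simp add: T_def p_def)
  have bp: "b * p = a * r - 2 * a - b"
    by (simp add: p_def power2_eq_square algebra_simps flip: br)
  \<comment> \<open>The leading terms of \<open>u\<close> are
    \<open>Q 1 - 3 * Q n = b + e n\<close>. In \<open>T n\<close>, the summand \<open>k = n\<close>
    is \<open>e n\<close> and the summand \<open>k = 1\<close> vanishes since
    \<open>e 1 = 0\<close>.\<close>
  have u: "u = b + T n"
  proof -
    have "T n = e n + (\<Sum>k = 2..n - 1. e k * r ^ (n - k))"
    proof -
      have "{1..n} = insert 1 (insert n {2..n - 1})" using n3 by auto
      then show ?thesis using n3 e_init by (simp add: T_def)
    qed
    then show ?thesis
      unfolding assms(3) by (simp add: e_def a_def b_def r_def)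
  qed
  \<comment> \<open>After expressing \<open>e n\<close> and \<open>e (n + 1)\<close> by
    \<open>a\<close> and \<open>b\<close>, what remains besides the right-hand side is
    \<open>a - b * r = 0\<close>.\<close>
  have pu: "p * u = 4 * (1 - r ^ n)"
    unfolding u distrib_left pT e_n e_n1
    using bp br by (simp add: algebra_simps)
  then have p0: "p \<noteq> 0" and u0: "u \<noteq> 0"
    using rn by auto
  \<comment> \<open>By \<open>pu\<close>, this is \<open>1 / (b * (1 - r ^ n))\<close>, the scalar
    in front of the geometric sum.\<close>
  define w where "w = 4 / (b * p * u)"
  have w: "w * (b * (1 - r ^ n)) = 1"
  proof -
    have "1 - r ^ n = p * u / 4" using pu by simp
    then show ?thesis using p0 u0 b_neg by (simp add: w_def)
  qed

  \<comment> \<open>Closed forms of the coefficients of the inverse\<close>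
  have q1: "q 1 = w * (1 - 2 * r ^ (n - 1) - r ^ (n - 2))"
  proof -
    have "(\<Sum>k = 1..n - 3. (Q (n - k + 2) - 3 * Q (n - k + 1)) * (Q n - 2) ^ (k - 1)
        / (Q 1 - Q (n + 1)) ^ k) = (\<Sum>k = 4..n. e k * r ^ (n - k)) / b"
      unfolding sum_divide_distrib
    proof (rule sum.reindex_bij_witness[where i = "\<lambda>k. n + 1 - k" and j = "\<lambda>k. n + 1 - k"])
      fix k assume k: "k \<in> {1..n - 3}"
      then have "n - k + 1 = n + 1 - k" "n - k + 2 = n + 1 - k + 1" "n - (n + 1 - k) = k - 1"
        using n3 by auto
      moreover have "b ^ k = b * b ^ (k - 1)"
        using k by (cases k) auto
      ultimately show "e (n + 1 - k) * r ^ (n - (n + 1 - k)) / b =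
          (Q (n - k + 2) - 3 * Q (n - k + 1)) * (Q n - 2) ^ (k - 1) / (Q 1 - Q (n + 1)) ^ k"
        unfolding a_def[symmetric] b_def[symmetric] by (simp add: e_def r_def power_divide)
    qed (use n3 in auto)
    \<comment> \<open>Splitting off \<open>e 2 = - 4\<close> and \<open>e 3 = - 8\<close> shows that
      the explicit term with factor 8 in \<open>q 1\<close> only completes the sum by its
      \<open>k = 3\<close> summand.\<close>
    moreover have "T n = - 4 * r ^ (n - 2) - 8 * r ^ (n - 3) + (\<Sum>k = 4..n. e k * r ^ (n - k))"
    proof -
      have "{1..n} = insert 1 (insert 2 (insert 3 {4..n}))" using n3 by auto
      then show ?thesis using n3 e_init by (simp add: T_def)
    qed
    moreover have "b ^ (n - 2) = b * b ^ (n - 3)"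
    proof -
      have "n - 2 = Suc (n - 3)" using n3 by simp
      then show ?thesis by simp
    qed
    ultimately have "q 1 = 1 / u *
        (1 - 8 * r ^ (n - 3) / b + (T n + 4 * r ^ (n - 2) + 8 * r ^ (n - 3)) / b)"
      unfolding assms(4) a_def[symmetric] b_def[symmetric] by (simp add: r_def power_divide)
    also have "\<dots> = (u + 4 * r ^ (n - 2)) / (u * b)"
      using u0 b_neg by (simp add: u field_simps)
    also have "\<dots> = (p * u + 4 * (p * r ^ (n - 2))) / (b * p * u)"
      using u0 p0 b_neg by (simp add: field_simps)
    also have "p * r ^ (n - 2) = r ^ n - 2 * r ^ (n - 1) - r ^ (n - 2)"
    proof -
      obtain l where "n = l + 2" using n3 that[of "n - 2"] by simp
      then show ?thesis by (simp add: p_def algebra_simps power2_eq_square)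
    qed
    finally show ?thesis
      by (simp add: pu w_def algebra_simps)
  qed
  have q2: "q 2 = w * (r - 2 - r ^ (n - 1))"
  proof -
    have "(\<Sum>k = 1..n - 2. (Q (n - k + 1) - 3 * Q (n - k))
        * ((Q n - 2) ^ (k - 1) / (Q 1 - Q (n + 1)) ^ k)) =
        (\<Sum>k = 2..n - 1. e k * r ^ (n - 1 - k)) / b"
      unfolding sum_divide_distrib
    proof (rule sum.reindex_bij_witness[where i = "\<lambda>k. n - k" and j = "\<lambda>k. n - k"])
      fix k assume k: "k \<in> {1..n - 2}"
      then have "n - 1 - (n - k) = k - 1"
        using n3 by auto
      moreover have "b ^ k = b * b ^ (k - 1)"
        using k by (cases k) auto
      ultimately show "e (n - k) * r ^ (n - 1 - (n - k)) / b =
          (Q (n - k + 1) - 3 * Q (n - k)) * ((Q n - 2) ^ (k - 1) / (Q 1 - Q (n + 1)) ^ k)"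
        unfolding a_def[symmetric] b_def[symmetric] by (simp add: e_def r_def power_divide)
    qed (use n3 in auto)
    moreover have "T (n - 1) = (\<Sum>k = 2..n - 1. e k * r ^ (n - 1 - k))"
    proof -
      have "{1..n - 1} = insert 1 {2..n - 1}" using n3 by auto
      then show ?thesis using n3 e_init by (simp add: T_def)
    qed
    ultimately have "q 2 = 1 / u * (- 3 + T (n - 1) / b)"
      unfolding assms(5) by simp
    also have "\<dots> = (- 3 * (b * p) + p * T (n - 1)) / (b * p * u)"
      using u0 p0 b_neg by (simp add: field_simps)
    \<comment> \<open>Inserting \<open>e n\<close> and \<open>e (n - 1)\<close> leaves
      \<open>b * r - a = 0\<close> besides the right-hand side.\<close>
    also have "- 3 * (b * p) + p * T (n - 1) = 4 * (r - 2 - r ^ (n - 1))"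
      using n3 br unfolding bp pT by (simp add: e_n e_pred[simplified] algebra_simps)
    finally show ?thesis
      by (simp add: w_def)
  qed
  \<comment> \<open>From index 2 on no power of the shift wraps around, so the three terms combine
    to \<open>p * r ^ (m - 2)\<close>, a single power of \<open>r\<close> up to a constant.\<close>
  have qm: "q (m + 1) = w * (r ^ m - 2 * r ^ (m - 1) - r ^ (m - 2))" if m: "2 \<le> m" "m < n" for m
  proof -
    obtain l where l: "m = l + 2" using m that[of "m - 2"] by simp
    have "q (m + 1) = 4 * a ^ l / (u * b ^ (l + 1))"
      using assms(6)[of "m + 1"] m by (simp add: l a_def b_def)
    also have "\<dots> = w * (p * r ^ l)"
      using u0 p0 b_neg by (simp add: w_def r_def power_divide field_simps)
    also have "p * r ^ l = r ^ m - 2 * r ^ (m - 1) - r ^ (m - 2)"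
      by (simp add: l p_def algebra_simps power2_eq_square)
    finally show ?thesis .
  qed
  \<comment> \<open>Periodic extensions to the integers let the negative indices produced by the
    shifts wrap around automatically.\<close>
  define C W where "C x = Q (nat (x mod int n) + 1)" and "W x = w * r ^ nat (x mod int n)" for x
  have C_eq: "C x = Q (nat x + 1)" and W_eq: "W x = w * r ^ nat x" if "0 \<le> x" "x < int n" for x
    using that by (simp_all add: C_def W_def)
  have C_per: "C (x + int n) = C x" and W_per: "W (x + int n) = W x" for x
    by (simp_all add: C_def W_def)
  have q_W: "q (nat (x mod int n) + 1) = W x - 2 * W (x - 1) - W (x - 2)" for x
  proof -
    define m where "m = nat (x mod int n)"
    have "m < n" using n3 by (simp add: m_def nat_less_iff)
    have "W (x - k) = W (int m - k)" for k
      using n3 by (simp add: W_def m_def mod_simps)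
    from this[of 0] this[of 1] this[of 2]
    have "W x - 2 * W (x - 1) - W (x - 2) = W (int m) - 2 * W (int m - 1) - W (int m - 2)"
      by simp
    also have "\<dots> = q (m + 1)"
    proof -
      \<comment> \<open>Both shifted indices wrap for \<open>m = 0\<close>, only
        \<open>m - 2\<close> wraps for \<open>m = 1\<close>, and neither wraps afterwards.\<close>
      consider "m = 0" | "m = 1" | "2 \<le> m" by linarith
      then show ?thesis
      proof cases
        case 1
        then show ?thesis
          using W_per[of "- 1"] W_per[of "- 2"] q1 n3
          by (simp add: W_eq nat_diff_distrib nat_add_distrib algebra_simps)
      next
        case 2
        then show ?thesis
          using W_per[of "- 1"] q2 n3 by (simp add: W_eq nat_diff_distrib algebra_simps numeral_2_eq_2)
      next
        case 3
        then show ?thesis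
          using qm[of m] \<open>m < n\<close> by (simp add: W_eq nat_diff_distrib algebra_simps)
      qed
    qed
    finally show ?thesis by (simp add: m_def)
  qed
  \<comment> \<open>The recurrence fails only where indices wrap. At 0 the value is
    \<open>Q 1 - 2 * Q n - Q (n - 1) = b\<close>; at 1, \<open>Q n\<close> stands in for
    \<open>Q 0 = 2\<close>, leaving \<open>2 - Q n = - a\<close>.\<close>
  have C_rec: "C (int i) - 2 * C (int i - 1) - C (int i - 2) =
      (if i = 0 then b else if i = 1 then - a else 0)" if "i < n" for i
  proof -
    consider "i = 0" | "i = 1" | "2 \<le> i" by linarith
    then show ?thesis
    proof cases
      case 1
      moreover have "C (- 1) = Q n"
        using C_per[of "- 1"] n3 by (simp add: C_eq nat_diff_distrib)
      moreover have "C (- 2) = Q (n - 1)"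
        using C_per[of "- 2"] n3 by (simp add: C_eq nat_diff_distrib Suc_diff_Suc numeral_2_eq_2)
      ultimately show ?thesis
        using n3 Q_pred by (simp add: C_eq b_def)
    next
      case 2
      moreover have "C (- 1) = Q n"
        using C_per[of "- 1"] n3 by (simp add: C_eq nat_diff_distrib)
      ultimately show ?thesis
        using n3 Q_init by (simp add: C_eq a_def numeral_2_eq_2)
    next
      case 3
      then obtain l where "i = l + 2" using that[of "i - 2"] by simp
      then show ?thesis
        using that Q_rec[of "l + 1"] by (simp add: C_eq nat_add_distrib algebra_simps)
    qed
  qed
  have main: "(\<Sum>i<n. Q (i + 1) * q (nat ((int d - int i) mod int n) + 1)) = (if d = 0 then 1 else 0)"
    if "d < n" for d
  proof -
    \<comment> \<open>In a cyclic convolution a shift moves from one factor to the other. This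
      transfers \<open>1 - 2 S - S\<^sup>2\<close> from \<open>W\<close> to \<open>C\<close>, where
      \<open>C_rec\<close> collapses the sum to two terms.\<close>
    have shift: "(\<Sum>i<n. C (int i) * W (int d - k - int i)) =
        (\<Sum>i<n. C (int i - k) * W (int d - int i))" for k
    proof -
      have "C (x + int n) * W (int d - k - (x + int n)) = C x * W (int d - k - x)" for x
        using C_per[of x] W_per[of "int d - k - (x + int n)"] by (simp add: algebra_simps)
      from sum_periodic_shift[of "\<lambda>x. C x * W (int d - k - x)", OF this, of "- k"]
      show ?thesis by simp
    qed
    have "(\<Sum>i<n. Q (i + 1) * q (nat ((int d - int i) mod int n) + 1)) =
        (\<Sum>i<n. C (int i) * (W (int d - int i) - 2 * W (int d - 1 - int i) - W (int d - 2 - int i)))"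
      unfolding q_W by (intro sum.cong) (simp_all add: C_eq algebra_simps)
    also have "\<dots> = (\<Sum>i<n. C (int i) * W (int d - int i))
        - 2 * (\<Sum>i<n. C (int i) * W (int d - 1 - int i))
        - (\<Sum>i<n. C (int i) * W (int d - 2 - int i))"
      by (simp add: algebra_simps sum.distrib sum_subtractf sum_distrib_left)
    also have "\<dots> = (\<Sum>i<n. (C (int i) - 2 * C (int i - 1) - C (int i - 2)) * W (int d - int i))"
      unfolding shift by (simp add: algebra_simps sum.distrib sum_subtractf sum_distrib_left)
    also have "\<dots> = (\<Sum>i<n. (if i = 0 then b * W (int d) else 0)
        + (if i = 1 then - a * W (int d - 1) else 0))"
      by (intro sum.cong) (auto simp: C_rec)
    also have "\<dots> = b * W (int d) - a * W (int d - 1)"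
      using n3 by (simp add: sum.distrib)
    \<comment> \<open>For \<open>d > 0\<close> the terms cancel by \<open>b * r = a\<close>. At
      \<open>d = 0\<close> the index \<open>- 1\<close> wraps to \<open>n - 1\<close>, which leaves
      \<open>w * b * (1 - r ^ n) = 1\<close>.\<close>
    also have "\<dots> = (if d = 0 then 1 else 0)"
    proof (cases d)
      case 0
      have "b * W 0 - a * W (- 1) = w * (b - a * r ^ (n - 1))"
        using W_per[of "- 1"] n3 by (simp add: W_eq nat_diff_distrib algebra_simps)
      also have "a * r ^ (n - 1) = b * r ^ n"
        using n3 by (simp flip: br add: power_eq_if[of r n])
      finally show ?thesis using 0 w by (simp add: algebra_simps)
    next
      case (Suc l)
      then show ?thesis
        using that by (simp add: W_eq nat_add_distrib flip: br)
    qed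
    finally show ?thesis .
  qed
  show ?thesis
    by (rule circ_inverts_mat) (use main in simp)
qed

end
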